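(* Let $V=\bigotimes_{i=1}^d V^{(i)}$ be the Hilbert tensor product of real Hilbert spaces $V^{(1)},\dots,V^{(d)}$, with norm $\|\cdot\|_V$. Let $a:V\times V\to\mathbb R$ be a bilinear form for which there are constants $c_0,c_1>0$ with $|a(u,v)|\le c_1\|u\|_V\|v\|_V$ for all $u,v\in V$ and $a(v,v)\ge c_0\|v\|_V^2$ for all $v\in V$, and let $\ell\in V^*$ be a bounded linear functional. Fix $r\in\mathbb N$ and fixed subatoms $\psi_i^{(j)}\in V^{(i)}$ ($1\le i\le d$, $1\le j\le r$), and let $\mathcal F_r\subset V$ be the associated rank-$r$ CP trial space. Let $u_r\in\mathcal F_r$ be the Galerkin solution, i.e. $a(u_r,v_r)=\ell(v_r)$ for all $v_r\in\mathcal F_r$. Then $$\|u_r\|_V\le\frac{1}{c_0}\|\ell\|_{V^*}.$$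
   Context: Each $V^{(i)}$ is a Hilbert space of functions of the $i$-th coordinate (the coordinates range over space, time and parameters), and the elementary tensor $\psi_1\otimes\cdots\otimes\psi_d$ is identified with the product function $x\mapsto\prod_{i=1}^d\psi_i(x_i)$. For fixed subatoms $\psi_i^{(j)}$, the rank-$r$ canonical polyadic (CP) trial space is the finite-dimensional linear subspace $$\mathcal F_r=\left\{\sum_{j=1}^r c^{(j)}\,\psi_1^{(j)}\otimes\cdots\otimes\psi_d^{(j)}\;:\;c^{(j)}\in\mathbb R\right\}\subset V.$$ The dual norm is $\|\ell\|_{V^*}=\sup_{v\in V\setminus\{0\}}\ell(v)/\|v\|_V$. *)

theory Defs
  imports "HOL-Analysis.Analysis"
begin

text \<open>
  A real Hilbert space given by a carrier and an inner product of its own, so that finitely many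
  different Hilbert spaces can be indexed by a natural number. Only the values of \<open>ip\<close> on the
  carrier matter. The common type \<open>'a\<close> is merely an ambient vector space (for instance the
  direct sum of the spaces in question); it need not carry a norm.
\<close>

definition hilbert_space_on :: "'a::real_vector set \<Rightarrow> ('a \<Rightarrow> 'a \<Rightarrow> real) \<Rightarrow> bool" where
  "hilbert_space_on S ip \<longleftrightarrow>
     subspace S \<and>
     (\<forall>x\<in>S. \<forall>y\<in>S. ip x y = ip y x) \<and>
     (\<forall>x\<in>S. \<forall>y\<in>S. \<forall>z\<in>S. ip (x + y) z = ip x z + ip y z) \<and>
     (\<forall>c. \<forall>x\<in>S. \<forall>y\<in>S. ip (c *\<^sub>R x) y = c * ip x y) \<and>
     (\<forall>x\<in>S. x \<noteq> 0 \<longrightarrow> ip x x > 0) \<and>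
     (\<forall>X::nat \<Rightarrow> 'a.
        (\<forall>n. X n \<in> S) \<and>
        (\<forall>e>0. \<exists>N. \<forall>m\<ge>N. \<forall>n\<ge>N. sqrt (ip (X m - X n) (X m - X n)) < e) \<longrightarrow>
        (\<exists>L\<in>S. (\<lambda>n. sqrt (ip (X n - L) (X n - L))) \<longlonglongrightarrow> 0))"

text \<open>
  The Hilbert space \<open>'v\<close> together with the map \<open>tens\<close>, sending \<open>x\<close> to the elementary tensor of
  \<open>x 1, \<dots>, x d\<close>, is a Hilbert tensor product of the spaces \<open>(H i, ip i)\<close>, \<open>1 \<le> i \<le> d\<close>:
  the completion of the span of the elementary tensors for the product inner product. These
  conditions determine \<open>'v\<close> and \<open>tens\<close> up to a unique isometric isomorphism, so any realisation,
  such as one by product functions, is covered. The values of \<open>x\<close> outside \<open>{1..d}\<close> are irrelevant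
  by the inner product condition.
\<close>

definition hilbert_tensor_product ::
  "nat \<Rightarrow> (nat \<Rightarrow> 'a::real_vector set) \<Rightarrow> (nat \<Rightarrow> 'a \<Rightarrow> 'a \<Rightarrow> real) \<Rightarrow>
   ((nat \<Rightarrow> 'a) \<Rightarrow> 'v::{real_inner,complete_space}) \<Rightarrow> bool" where
  "hilbert_tensor_product d H ip tens \<longleftrightarrow>
     (\<forall>i\<in>{1..d}. hilbert_space_on (H i) (ip i)) \<and>
     (\<forall>x\<in>Pi {1..d} H. \<forall>i\<in>{1..d}. \<forall>u\<in>H i. \<forall>w\<in>H i.
        tens (x(i := u + w)) = tens (x(i := u)) + tens (x(i := w))) \<and>
     (\<forall>x\<in>Pi {1..d} H. \<forall>i\<in>{1..d}. \<forall>u\<in>H i. \<forall>c.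
        tens (x(i := c *\<^sub>R u)) = c *\<^sub>R tens (x(i := u))) \<and>
     (\<forall>x\<in>Pi {1..d} H. \<forall>y\<in>Pi {1..d} H.
        inner (tens x) (tens y) = (\<Prod>i=1..d. ip i (x i) (y i))) \<and>
     closure (span (tens ` Pi {1..d} H)) = UNIV"

text \<open>Here \<open>\<psi> i j\<close> is the \<open>j\<close>-th subatom in coordinate \<open>i\<close>.\<close>

definition cp_trial_space ::
  "((nat \<Rightarrow> 'a) \<Rightarrow> 'v::real_vector) \<Rightarrow> nat \<Rightarrow> (nat \<Rightarrow> nat \<Rightarrow> 'a) \<Rightarrow> 'v set" where
  "cp_trial_space tens r \<psi> = {\<Sum>j=1..r. c j *\<^sub>R tens (\<lambda>i. \<psi> i j) | c :: nat \<Rightarrow> real. True}"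

definition galerkin_solution ::
  "('v \<Rightarrow> 'v \<Rightarrow> real) \<Rightarrow> ('v \<Rightarrow> real) \<Rightarrow> 'v set \<Rightarrow> 'v \<Rightarrow> bool" where
  "galerkin_solution a l F u \<longleftrightarrow> u \<in> F \<and> (\<forall>v\<in>F. a u v = l v)"

text \<open>
  On the zero space the supremum ranges over the empty set, where \<open>Sup\<close> on the reals is
  unspecified; the dual norm is 0 there.
\<close>

definition dual_norm :: "('v::real_normed_vector \<Rightarrow> real) \<Rightarrow> real" where
  "dual_norm l = (if (UNIV :: 'v set) = {0} then 0 else (SUP v\<in>UNIV - {0}. l v / norm v))"

lemma dual_norm_eq_onorm:
  fixes l :: "'v::real_normed_vector \<Rightarrow> real"
  assumes "bounded_linear l"
  shows "dual_norm l = onorm l"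
proof (cases "(UNIV :: 'v set) = {0}")
  case True
  then have "l = (\<lambda>x. 0)"
    using linear_0[OF bounded_linear.linear[OF assms]] by (metis UNIV_I singletonD)
  with True show ?thesis
    by (simp add: dual_norm_def onorm_zero)
next
  case False
  then obtain w :: 'v where w: "w \<noteq> 0" by blast
  have le: "l v / norm v \<le> onorm l" for v
    using onorm[OF assms, of v] onorm_pos_le[OF assms]
    by (cases "v = 0") (auto simp: divide_le_eq)
  have bdd: "bdd_above ((\<lambda>v. l v / norm v) ` (UNIV - {0}))"
    using le by (intro bdd_aboveI2)
  have lem: "l v / norm v \<le> (SUP v\<in>UNIV - {0}. l v / norm v)" if "v \<noteq> 0" for v
    using bdd that by (intro cSUP_upper) auto
  have neg: "l (- v) = - l v" for v
    using linear_neg[OF bounded_linear.linear[OF assms]] by simp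
  have abs: "\<bar>l v\<bar> / norm v \<le> (SUP v\<in>UNIV - {0}. l v / norm v)" if "v \<noteq> 0" for v
    using lem[of v] lem[of "- v"] that neg[of v] by (auto simp: abs_if)
  have nonneg: "0 \<le> (SUP v\<in>UNIV - {0}. l v / norm v)"
    using abs[OF w] by (meson abs_ge_zero divide_nonneg_nonneg norm_ge_zero order_trans)
  have "onorm l \<le> (SUP v\<in>UNIV - {0}. l v / norm v)"
  proof (rule onorm_bound[OF nonneg])
    fix v show "norm (l v) \<le> (SUP v\<in>UNIV - {0}. l v / norm v) * norm v"
      using abs[of v] linear_0[OF bounded_linear.linear[OF assms]]
      by (cases "v = 0") (auto simp: divide_le_eq)
  qed
  moreover have "(SUP v\<in>UNIV - {0}. l v / norm v) \<le> onorm l"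
    using w le by (intro cSUP_least) auto
  ultimately show ?thesis using False by (simp add: dual_norm_def)
qed

end

theory Submission imports Defs begin

text \<open>The Galerkin solution lies in the trial space, so it may serve as its own test function.
  Coercivity bounds the energy \<open>a u\<^sub>r u\<^sub>r = l u\<^sub>r\<close> from below by
  \<open>c\<^sub>0 * (norm u\<^sub>r)\<^sup>2\<close>, and the dual norm bounds it from above by
  \<open>dual_norm l * norm u\<^sub>r\<close>; cancelling one factor \<open>norm u\<^sub>r\<close>
  gives the estimate. \<open>dual_norm_eq_onorm\<close> supplies the properties of the dual norm
  from those of the operator norm.\<close>

theorem theorem5:
  fixes d r :: nat
    and H :: "nat \<Rightarrow> 'a::real_vector set"
    and ip :: "nat \<Rightarrow> 'a \<Rightarrow> 'a \<Rightarrow> real"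
    and tens :: "(nat \<Rightarrow> 'a) \<Rightarrow> 'v::{real_inner,complete_space}"
    and a :: "'v \<Rightarrow> 'v \<Rightarrow> real"
    and l :: "'v \<Rightarrow> real"
    and c\<^sub>0 c\<^sub>1 :: real
    and \<psi> :: "nat \<Rightarrow> nat \<Rightarrow> 'a"
    and u\<^sub>r :: 'v
  assumes "hilbert_tensor_product d H ip tens"
    and "bilinear a"
    and "c\<^sub>0 > 0" and "c\<^sub>1 > 0"
    and "\<And>u v. \<bar>a u v\<bar> \<le> c\<^sub>1 * norm u * norm v"
    and "\<And>v. a v v \<ge> c\<^sub>0 * (norm v)\<^sup>2"
    and "bounded_linear l"
    and "\<And>i j. i \<in> {1..d} \<Longrightarrow> j \<in> {1..r} \<Longrightarrow> \<psi> i j \<in> H i"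
    and "galerkin_solution a l (cp_trial_space tens r \<psi>) u\<^sub>r"
  shows "norm u\<^sub>r \<le> 1 / c\<^sub>0 * dual_norm l"
proof -
  have le: "l u\<^sub>r \<le> dual_norm l * norm u\<^sub>r"
    using onorm[OF \<open>bounded_linear l\<close>, of u\<^sub>r] dual_norm_eq_onorm[OF \<open>bounded_linear l\<close>]
    by simp
  have "c\<^sub>0 * (norm u\<^sub>r)\<^sup>2 \<le> a u\<^sub>r u\<^sub>r"
    by fact
  \<comment> \<open>Galerkin equation tested with \<open>v = u\<^sub>r\<close>.\<close>
  also have "a u\<^sub>r u\<^sub>r = l u\<^sub>r"
    using assms(9) by (simp add: galerkin_solution_def)
  also note le
  finally have "(c\<^sub>0 * norm u\<^sub>r) * norm u\<^sub>r \<le> dual_norm l * norm u\<^sub>r"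
    by (simp add: power2_eq_square mult.assoc)
  \<comment> \<open>Covers \<open>u\<^sub>r = 0\<close>, where the factor
    \<open>norm u\<^sub>r\<close> cannot be cancelled.\<close>
  moreover have "0 \<le> dual_norm l"
    using onorm_pos_le dual_norm_eq_onorm \<open>bounded_linear l\<close> by metis
  ultimately have "c\<^sub>0 * norm u\<^sub>r \<le> dual_norm l"
    by (cases "u\<^sub>r = 0") auto
  then show ?thesis
    using \<open>c\<^sub>0 > 0\<close> by (simp add: field_simps)
qed

end
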